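(* Fix $n\ge 1$ and $\varepsilon\in(0,1)$, and let $\mathcal{C}=\{(C_1,C_2)^\top\in\mathbb{R}^2: C_1\ge 0,\ C_2\ge 0,\ C_1+C_2\le 1-\varepsilon\}$. In the limit of vanishing trust-region radius $r\to0$, followed by $\mathcal{R}_1\to 0$, the barycenter of the weight coefficient region $\mathcal{C}$ is given by $C_1=C_2=\frac{1-\varepsilon}{3}$. Precisely: the function $$(C_1,C_2)\ \mapsto\ \lim_{\mathcal{R}_1\to 0}\ \lim_{r\to 0}\ \mathrm{Error}_{\mathrm{ave}}(C_1,C_2,n,r,\varepsilon)$$ is well defined on $\mathcal{C}$ (the inner limit is taken with the interpolation points $\boldsymbol{y}_1,\dots,\boldsymbol{y}_p$ and base point $\boldsymbol{x}_k$ fixed; the outer limit is along any sequence of such point configurations for which $\mathcal{R}_1=\mathcal{R}_1(\boldsymbol{y}_1,\dots,\boldsymbol{y}_p)\to 0$), and its unique minimizer over $\mathcal{C}$ is $\left(\frac{1-\varepsilon}{3},\frac{1-\varepsilon}{3}\right)^\top$.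
   Context: Setting: $\boldsymbol{x}_k\in\mathbb{R}^n$ is a base point, $\boldsymbol{y}_1,\dots,\boldsymbol{y}_p\in\mathbb{R}^n$ ($p\ge1$) are interpolation points, $r>0$, $(C_1,C_2)^\top\in\mathcal{C}$ and $C_3:=1-C_1-C_2\ (\ge\varepsilon)$. Put $$\eta_1=C_1\tfrac{r^4}{2(n+4)(n+2)}+C_2\tfrac{r^2}{n+2}+C_3,\quad \eta_2=C_1\tfrac{r^2}{n+2}+C_2,\quad \eta_3=C_1\tfrac{r^4}{4(n+4)(n+2)},\quad \eta_4=C_1\tfrac{r^2}{n+2},\quad \eta_5=C_1.$$ The KKT matrix $\boldsymbol{W}=\boldsymbol{W}(C_1,C_2,n,r)$ is the symmetric $(p+1+n)\times(p+1+n)$ matrix $$\boldsymbol{W}=\begin{pmatrix}\boldsymbol{A}&\boldsymbol{J}&\boldsymbol{X}\\ \boldsymbol{J}^\top&\frac{n\eta_4^2}{2n\eta_3+2\eta_1}-2\eta_5&\boldsymbol{0}_n^\top\\ \boldsymbol{X}^\top&\boldsymbol{0}_n&-2\eta_2\boldsymbol{I}\end{pmatrix},$$ where $\boldsymbol{I}$ is the $n\times n$ identity, $\boldsymbol{0}_n$ is the zero vector in $\mathbb{R}^n$, $$\boldsymbol{A}_{ij}=\tfrac{1}{8\eta_1}\left((\boldsymbol{y}_i-\boldsymbol{x}_k)^\top(\boldsymbol{y}_j-\boldsymbol{x}_k)\right)^2-\tfrac{\eta_3}{8\eta_1(n\eta_3+\eta_1)}\|\boldsymbol{y}_i-\boldsymbol{x}_k\|_2^2\,\|\boldsymbol{y}_j-\boldsymbol{x}_k\|_2^2\quad(1\le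 i,j\le p),$$ $\boldsymbol{X}=(\boldsymbol{y}_1-\boldsymbol{x}_k,\dots,\boldsymbol{y}_p-\boldsymbol{x}_k)^\top\in\mathbb{R}^{p\times n}$, and $\boldsymbol{J}\in\mathbb{R}^p$ has entries $\boldsymbol{J}_i=1-\frac{\eta_4}{4n\eta_3+4\eta_1}\|\boldsymbol{y}_i-\boldsymbol{x}_k\|_2^2$. For $(C_1,C_2)^\top,(C_1^*,C_2^* )^\top\in\mathcal{C}$, set $\mathcal{D}(C_1,C_2,C_1^*,C_2^*,n,r)=\|\boldsymbol{W}(C_1,C_2,n,r)-\boldsymbol{W}(C_1^*,C_2^*,n,r)\|_F^2$ (same points, same $r$; this depends also on the points). The average squared KKT matrix error is the mean over the triangle $\mathcal{C}$: $$\mathrm{Error}_{\mathrm{ave}}(C_1,C_2,n,r,\varepsilon)=\frac{2}{(1-\varepsilon)^2}\iint_{\mathcal{C}}\mathcal{D}(C_1,C_2,C_1^*,C_2^*,n,r)\,dC_1^*\,dC_2^*.$$ The barycenter of the weight coefficient region $\mathcal{C}$ is the minimizer over $(C_1,C_2)^\top\in\mathcal{C}$ of the average squared KKT matrix error. Finally, $$\mathcal{R}_1(\boldsymbol{y}_1,\dots,\boldsymbol{y}_p)=\sum_{i=1}^{p}\sum_{j=1}^{p}\left[(\boldsymbol{y}_i-\boldsymbol{x}_k)^\top(\boldsymbol{y}_j-\boldsymbol{x}_k)\right]^4.$$ *)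

theory Defs
  imports "HOL-Analysis.Analysis"
begin

text \<open>
  The dimension n is \<open>CARD('n)\<close> and the number p of interpolation points is \<open>CARD('p)\<close>;
  both are at least 1 since types are nonempty. A point configuration consists of a base point
  \<open>x :: real ^ 'n\<close> and interpolation points \<open>y :: 'p \<Rightarrow> real ^ 'n\<close>.
\<close>

definition weight_region :: "real \<Rightarrow> (real \<times> real) set" where
  "weight_region \<epsilon> = {(C1, C2). C1 \<ge> 0 \<and> C2 \<ge> 0 \<and> C1 + C2 \<le> 1 - \<epsilon>}"

definition eta1 :: "real \<Rightarrow> real \<Rightarrow> nat \<Rightarrow> real \<Rightarrow> real" where
  "eta1 C1 C2 n r =
     C1 * (r ^ 4 / (2 * (real n + 4) * (real n + 2))) + C2 * (r\<^sup>2 / (real n + 2)) + (1 - C1 - C2)"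

definition eta2 :: "real \<Rightarrow> real \<Rightarrow> nat \<Rightarrow> real \<Rightarrow> real" where
  "eta2 C1 C2 n r = C1 * (r\<^sup>2 / (real n + 2)) + C2"

definition eta3 :: "real \<Rightarrow> real \<Rightarrow> nat \<Rightarrow> real \<Rightarrow> real" where
  "eta3 C1 C2 n r = C1 * (r ^ 4 / (4 * (real n + 4) * (real n + 2)))"

definition eta4 :: "real \<Rightarrow> real \<Rightarrow> nat \<Rightarrow> real \<Rightarrow> real" where
  "eta4 C1 C2 n r = C1 * (r\<^sup>2 / (real n + 2))"

definition eta5 :: "real \<Rightarrow> real \<Rightarrow> nat \<Rightarrow> real \<Rightarrow> real" where
  "eta5 C1 C2 n r = C1"

definition kkt_A :: "real \<Rightarrow> real \<Rightarrow> real \<Rightarrow> real ^ 'n \<Rightarrow> ('p \<Rightarrow> real ^ 'n) \<Rightarrow> real ^ 'p ^ 'p" where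
  "kkt_A C1 C2 r x y =
     (let n = CARD('n); e1 = eta1 C1 C2 n r; e3 = eta3 C1 C2 n r
      in \<chi> i j. 1 / (8 * e1) * ((y i - x) \<bullet> (y j - x))\<^sup>2
               - e3 / (8 * e1 * (real n * e3 + e1)) * (norm (y i - x))\<^sup>2 * (norm (y j - x))\<^sup>2)"

definition kkt_X :: "real ^ 'n \<Rightarrow> ('p \<Rightarrow> real ^ 'n) \<Rightarrow> real ^ 'n ^ 'p" where
  "kkt_X x y = (\<chi> i. y i - x)"

definition kkt_J :: "real \<Rightarrow> real \<Rightarrow> real \<Rightarrow> real ^ 'n \<Rightarrow> ('p \<Rightarrow> real ^ 'n) \<Rightarrow> real ^ 'p" where
  "kkt_J C1 C2 r x y =
     (let n = CARD('n); e1 = eta1 C1 C2 n r; e3 = eta3 C1 C2 n r; e4 = eta4 C1 C2 n r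
      in \<chi> i. 1 - e4 / (4 * real n * e3 + 4 * e1) * (norm (y i - x))\<^sup>2)"

definition kkt_mid :: "real \<Rightarrow> real \<Rightarrow> nat \<Rightarrow> real \<Rightarrow> real" where
  "kkt_mid C1 C2 n r =
     real n * (eta4 C1 C2 n r)\<^sup>2 / (2 * real n * eta3 C1 C2 n r + 2 * eta1 C1 C2 n r)
     - 2 * eta5 C1 C2 n r"

text \<open>
  The three summands of the index type \<open>'p + unit + 'n\<close> correspond to the three block rows
  (and columns), of sizes p, 1 and n.
\<close>

definition kkt_W ::
  "real \<Rightarrow> real \<Rightarrow> real \<Rightarrow> real ^ 'n \<Rightarrow> ('p \<Rightarrow> real ^ 'n)
     \<Rightarrow> real ^ ('p::finite + unit + 'n::finite) ^ ('p + unit + 'n)" where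
  "kkt_W C1 C2 r x y = (\<chi> a b.
     (case a of
        Inl i \<Rightarrow>
          (case b of
             Inl j \<Rightarrow> kkt_A C1 C2 r x y $ i $ j
           | Inr (Inl _) \<Rightarrow> kkt_J C1 C2 r x y $ i
           | Inr (Inr l) \<Rightarrow> kkt_X x y $ i $ l)
      | Inr (Inl _) \<Rightarrow>
          (case b of
             Inl j \<Rightarrow> kkt_J C1 C2 r x y $ j
           | Inr (Inl _) \<Rightarrow> kkt_mid C1 C2 CARD('n) r
           | Inr (Inr l) \<Rightarrow> 0)
      | Inr (Inr k) \<Rightarrow>
          (case b of
             Inl j \<Rightarrow> transpose (kkt_X x y) $ k $ j
           | Inr (Inl _) \<Rightarrow> 0
           | Inr (Inr l) \<Rightarrow> (- 2 * eta2 C1 C2 CARD('n) r) * (mat 1 :: real ^ 'n ^ 'n) $ k $ l)))"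

text \<open>
  The library norm on \<open>real ^ 'a ^ 'b\<close> is the Euclidean norm of the vector of Euclidean row norms,
  i.e. the Frobenius norm.
\<close>

definition kkt_dist ::
  "real \<Rightarrow> real \<Rightarrow> real \<Rightarrow> real \<Rightarrow> real \<Rightarrow> real ^ 'n::finite \<Rightarrow> ('p::finite \<Rightarrow> real ^ 'n) \<Rightarrow> real" where
  "kkt_dist C1 C2 C1' C2' r x y = (norm (kkt_W C1 C2 r x y - kkt_W C1' C2' r x y))\<^sup>2"

definition Error_ave ::
  "real \<Rightarrow> real \<Rightarrow> real \<Rightarrow> real \<Rightarrow> real ^ 'n::finite \<Rightarrow> ('p::finite \<Rightarrow> real ^ 'n) \<Rightarrow> real" where
  "Error_ave C1 C2 r \<epsilon> x y =
     2 / (1 - \<epsilon>)\<^sup>2 *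
     (LINT c : weight_region \<epsilon> | lborel. kkt_dist C1 C2 (fst c) (snd c) r x y)"

definition R1 :: "real ^ 'n \<Rightarrow> ('p::finite \<Rightarrow> real ^ 'n) \<Rightarrow> real" where
  "R1 x y = (\<Sum>i\<in>UNIV. \<Sum>j\<in>UNIV. ((y i - x) \<bullet> (y j - x)) ^ 4)"

end

theory Submission
  imports Defs
begin

text \<open>
  At \<open>r = 0\<close> the squared KKT distance is
  \<open>R1 / 64 * (1/C3 - 1/C3')\<^sup>2 + 4 * (C1 - C1')\<^sup>2 + 4 * n * (C2 - C2')\<^sup>2\<close>, and it depends
  continuously on \<open>r\<close> and the weights, so the limit \<open>r \<rightarrow> 0\<close> passes through the integral and is
  the value at \<open>r = 0\<close>. Letting \<open>R1 \<rightarrow> 0\<close> leaves the mean of a positive definite diagonal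
  quadratic form in the difference of the weights, which is uniquely minimized at the centroid of
  the triangle.
\<close>

section \<open>The weight region, and the squared KKT distance block by block\<close>

lemma eta_at_0 [simp]:
  "eta1 C1 C2 n 0 = 1 - C1 - C2" "eta2 C1 C2 n 0 = C2" "eta3 C1 C2 n 0 = 0"
  "eta4 C1 C2 n 0 = 0" "eta5 C1 C2 n r = C1"
  by (simp_all add: eta1_def eta2_def eta3_def eta4_def eta5_def)

lemma compact_weight_region: "compact (weight_region \<epsilon>)"
proof -
  have "weight_region \<epsilon> = ({c. 0 \<le> fst c} \<inter> {c. 0 \<le> snd c}) \<inter> {c. fst c + snd c \<le> 1 - \<epsilon>}"
    by (auto simp: weight_region_def)
  also have "closed \<dots>"
    by (intro closed_Int closed_Collect_le continuous_intros)
  finally have "closed (weight_region \<epsilon>)" .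
  moreover have "weight_region \<epsilon> \<subseteq> {0..1 - \<epsilon>} \<times> {0..1 - \<epsilon>}"
    by (auto simp: weight_region_def)
  then have "bounded (weight_region \<epsilon>)"
    by (rule bounded_subset[rotated]) (simp add: bounded_Times)
  ultimately show ?thesis
    by (simp add: compact_eq_bounded_closed)
qed

text \<open>The term \<open>1 - C1 - C2\<close> is at least \<epsilon> on the region and the other
  two summands are nonnegative, so every denominator in the KKT matrix stays away from zero for all
  \<open>r\<close>.\<close>

lemma eta1_pos:
  assumes "0 < \<epsilon>" "(C1, C2) \<in> weight_region \<epsilon>"
  shows "0 < eta1 C1 C2 n r"
  using assms by (auto simp: eta1_def weight_region_def intro!: add_nonneg_pos)

lemma eta3_nonneg: "(C1, C2) \<in> weight_region \<epsilon> \<Longrightarrow> 0 \<le> eta3 C1 C2 n r"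
  by (auto simp: eta3_def weight_region_def)

text \<open>The Frobenius norm sums over all pairs of indices, and the sum type splits them into
  blocks. The vector block \<open>kkt_J\<close> occurs twice by symmetry, hence the factor 2; the
  blocks from \<open>kkt_X\<close> do not depend on the weights and cancel; the scaled identity
  block has \<open>CARD('n)\<close> diagonal entries, each contributing four times the squared
  difference of \<open>eta2\<close>.\<close>

lemma kkt_dist_eq:
  fixes x :: "real ^ 'n::finite" and y :: "'p::finite \<Rightarrow> real ^ 'n"
  shows "kkt_dist C1 C2 C1' C2' r x y =
    (\<Sum>i\<in>UNIV. \<Sum>j\<in>UNIV. (kkt_A C1 C2 r x y $ i $ j - kkt_A C1' C2' r x y $ i $ j)\<^sup>2)
    + 2 * (\<Sum>i\<in>UNIV. (kkt_J C1 C2 r x y $ i - kkt_J C1' C2' r x y $ i)\<^sup>2)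
    + (kkt_mid C1 C2 CARD('n) r - kkt_mid C1' C2' CARD('n) r)\<^sup>2
    + 4 * real CARD('n) * (eta2 C1 C2 CARD('n) r - eta2 C1' C2' CARD('n) r)\<^sup>2"
proof -
  have sum_split: "(\<Sum>a\<in>UNIV. f a) = (\<Sum>i\<in>UNIV. f (Inl i)) + (f (Inr (Inl ())) + (\<Sum>k\<in>UNIV. f (Inr (Inr k))))"
    for f :: "'p + unit + 'n \<Rightarrow> real"
    by (simp add: sum.Plus UNIV_Plus_UNIV[symmetric] UNIV_unit del: UNIV_Plus_UNIV)
  have diag: "(\<Sum>k\<in>UNIV. \<Sum>l\<in>UNIV. (- 2 * e * (mat 1 :: real ^ 'n ^ 'n) $ k $ l - (- 2 * e' * (mat 1 :: real ^ 'n ^ 'n) $ k $ l))\<^sup>2)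
      = 4 * real CARD('n) * (e - e')\<^sup>2" for e e' :: real
  proof -
    have "(- 2 * e * (mat 1 :: real ^ 'n ^ 'n) $ k $ l - (- 2 * e' * (mat 1 :: real ^ 'n ^ 'n) $ k $ l))\<^sup>2
        = (if k = l then 4 * (e - e')\<^sup>2 else 0)" for k l
      by (simp add: mat_def power2_eq_square algebra_simps)
    then show ?thesis
      by simp
  qed
  have "kkt_dist C1 C2 C1' C2' r x y =
      (\<Sum>a\<in>UNIV. \<Sum>b\<in>UNIV. (kkt_W C1 C2 r x y $ a $ b - kkt_W C1' C2' r x y $ a $ b)\<^sup>2)"
    unfolding kkt_dist_def power2_norm_eq_inner by (simp add: inner_vec_def power2_eq_square)
  also have "\<dots> = (\<Sum>i\<in>UNIV. \<Sum>j\<in>UNIV. (kkt_A C1 C2 r x y $ i $ j - kkt_A C1' C2' r x y $ i $ j)\<^sup>2)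
    + 2 * (\<Sum>i\<in>UNIV. (kkt_J C1 C2 r x y $ i - kkt_J C1' C2' r x y $ i)\<^sup>2)
    + (kkt_mid C1 C2 CARD('n) r - kkt_mid C1' C2' CARD('n) r)\<^sup>2
    + (\<Sum>k\<in>UNIV. \<Sum>l\<in>UNIV. (- 2 * eta2 C1 C2 CARD('n) r * (mat 1 :: real ^ 'n ^ 'n) $ k $ l
        - (- 2 * eta2 C1' C2' CARD('n) r * (mat 1 :: real ^ 'n ^ 'n) $ k $ l))\<^sup>2)"
    unfolding sum_split kkt_W_def by (simp add: sum.distrib transpose_def)
  finally show ?thesis
    unfolding diag .
qed

text \<open>With \<open>eta3\<close> and \<open>eta4\<close> vanishing, \<open>kkt_J\<close> is the
  all-ones vector for both weights and drops out, \<open>kkt_mid\<close> becomes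
  \<open>- 2 * C1\<close>, and each entry of \<open>kkt_A\<close> is a squared Gram entry divided by
  \<open>8 * (1 - C1 - C2)\<close>. Squaring the differences of these entries produces the fourth
  powers that make up \<open>R1\<close>.\<close>

lemma kkt_dist_at_0:
  fixes x :: "real ^ 'n::finite" and y :: "'p::finite \<Rightarrow> real ^ 'n"
  shows "kkt_dist C1 C2 C1' C2' 0 x y =
    R1 x y * ((1 / (1 - C1 - C2) - 1 / (1 - C1' - C2'))\<^sup>2 / 64)
    + (4 * (C1 - C1')\<^sup>2 + 4 * real CARD('n) * (C2 - C2')\<^sup>2)"
proof -
  have A: "(kkt_A C1 C2 0 x y $ i $ j - kkt_A C1' C2' 0 x y $ i $ j)\<^sup>2
      = ((y i - x) \<bullet> (y j - x)) ^ 4 * ((1 / (1 - C1 - C2) - 1 / (1 - C1' - C2'))\<^sup>2 / 64)" for i j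
  proof -
    have "kkt_A C1 C2 0 x y $ i $ j - kkt_A C1' C2' 0 x y $ i $ j
        = ((y i - x) \<bullet> (y j - x))\<^sup>2 * ((1 / (1 - C1 - C2) - 1 / (1 - C1' - C2')) / 8)"
      by (simp add: kkt_A_def Let_def algebra_simps diff_divide_distrib)
    then show ?thesis
      by (simp only: power_mult_distrib power_divide power_mult[symmetric]) simp
  qed
  have "(kkt_mid C1 C2 CARD('n) 0 - kkt_mid C1' C2' CARD('n) 0)\<^sup>2 = 4 * (C1 - C1')\<^sup>2"
    by (simp add: kkt_mid_def power2_eq_square algebra_simps)
  then show ?thesis
    unfolding kkt_dist_eq A R1_def sum_distrib_right by (simp add: kkt_J_def)
qed

section \<open>Continuity in the radius and the weights, and the limit of vanishing radius\<close>

lemma continuous_on_kkt_dist: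
  fixes x :: "real ^ 'n::finite" and y :: "'p::finite \<Rightarrow> real ^ 'n"
  assumes "0 < \<epsilon>" "(C1, C2) \<in> weight_region \<epsilon>"
  shows "continuous_on (S \<times> weight_region \<epsilon>)
    (\<lambda>z. kkt_dist C1 C2 (fst (snd z)) (snd (snd z)) (fst z) x y)"
proof -
  \<comment> \<open>These are the factors and denominators dividing in \<open>kkt_A\<close>,
    \<open>kkt_mid\<close> and \<open>kkt_J\<close>; positivity of \<open>eta1\<close> and
    nonnegativity of \<open>eta3\<close> keep all of them nonzero.\<close>
  have pos: "eta1 C C' n r \<noteq> 0" "real m * eta3 C C' n r + eta1 C C' n r \<noteq> 0"
      "2 * real m * eta3 C C' n r + 2 * eta1 C C' n r \<noteq> 0"
      "4 * real m * eta3 C C' n r + 4 * eta1 C C' n r \<noteq> 0"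
    if "(C, C') \<in> weight_region \<epsilon>" for C C' n m r
  proof -
    have *: "0 < eta1 C C' n r" "0 \<le> real m * eta3 C C' n r"
      using eta1_pos[OF assms(1) that] eta3_nonneg[OF that] by simp_all
    then show "eta1 C C' n r \<noteq> 0" by simp
    from * show "real m * eta3 C C' n r + eta1 C C' n r \<noteq> 0"
      "2 * real m * eta3 C C' n r + 2 * eta1 C C' n r \<noteq> 0"
      "4 * real m * eta3 C C' n r + 4 * eta1 C C' n r \<noteq> 0"
      by linarith+
  qed
  have eta: "continuous_on T (\<lambda>z. eta1 (f z) (g z) n (h z))"
     "continuous_on T (\<lambda>z. eta2 (f z) (g z) n (h z))"
     "continuous_on T (\<lambda>z. eta3 (f z) (g z) n (h z))"
     "continuous_on T (\<lambda>z. eta4 (f z) (g z) n (h z))"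
    if "continuous_on T f" "continuous_on T g" "continuous_on T h"
    for T :: "(real \<times> real \<times> real) set" and f g h n
    unfolding eta1_def eta2_def eta3_def eta4_def divide_inverse
    by (intro continuous_intros that)+
  show ?thesis
    unfolding kkt_dist_eq kkt_A_def kkt_J_def kkt_mid_def Let_def vec_lambda_beta eta_at_0(5)
    using assms(2)
    by (intro continuous_intros eta ballI) (auto simp: pos)
qed

lemma continuous_on_kkt_dist_weights:
  fixes x :: "real ^ 'n::finite" and y :: "'p::finite \<Rightarrow> real ^ 'n"
  assumes "0 < \<epsilon>" "(C1, C2) \<in> weight_region \<epsilon>"
  shows "continuous_on (weight_region \<epsilon>) (\<lambda>c. kkt_dist C1 C2 (fst c) (snd c) r x y)"
proof -
  have "continuous_on (weight_region \<epsilon>) (\<lambda>c. (r, c))"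
    by (intro continuous_intros)
  from continuous_on_compose2[OF continuous_on_kkt_dist[OF assms] this, of "{r}" x y]
  show ?thesis
    by auto
qed

lemma set_integrable_weight_region:
  fixes f :: "real \<times> real \<Rightarrow> real"
  assumes "continuous_on (weight_region \<epsilon>) f"
  shows "set_integrable lborel (weight_region \<epsilon>) f"
  unfolding set_integrable_def
  by (rule borel_integrable_compact[OF compact_weight_region assms])

text \<open>Dominated convergence: joint continuity on the compact set
  \<open>{0..1} \<times> weight_region \<epsilon>\<close> gives one bound \<open>B\<close> for all
  small radii, and a constant is integrable over the compact triangle.\<close>

lemma Error_ave_tendsto:
  fixes x :: "real ^ 'n::finite" and y :: "'p::finite \<Rightarrow> real ^ 'n"
  assumes "0 < \<epsilon>" "(C1, C2) \<in> weight_region \<epsilon>"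
  shows "((\<lambda>r. Error_ave C1 C2 r \<epsilon> x y) \<longlongrightarrow> Error_ave C1 C2 0 \<epsilon> x y) (at_right 0)"
proof -
  define D where "D r c = kkt_dist C1 C2 (fst c) (snd c) r x y" for r c
  let ?T = "weight_region \<epsilon>"
  have cont: "continuous_on ({0..1} \<times> ?T) (\<lambda>z. D (fst z) (snd z))"
    unfolding D_def by (rule continuous_on_kkt_dist[OF assms])
  have "compact ((\<lambda>z. D (fst z) (snd z)) ` ({0..1} \<times> ?T))"
    by (intro compact_continuous_image cont compact_Times compact_weight_region compact_Icc)
  then obtain B where B: "\<And>r c. r \<in> {0..1} \<Longrightarrow> c \<in> ?T \<Longrightarrow> norm (D r c) \<le> B"
    by (force simp: bounded_iff dest!: compact_imp_bounded)
  have int: "set_integrable lborel ?T (D r)" for r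
    unfolding D_def
    by (intro set_integrable_weight_region continuous_on_kkt_dist_weights assms)
  \<comment> \<open>Restricting to \<open>{0..1}\<close> makes \<open>B\<close> valid along every
    approaching sequence; near 0 this filter is the same as \<open>at_right 0\<close>.\<close>
  have "((\<lambda>r. LINT c:?T|lborel. D r c) \<longlongrightarrow> (LINT c:?T|lborel. D 0 c)) (at 0 within {0..1})"
    unfolding tendsto_at_iff_sequentially
  proof (intro allI impI)
    fix s :: "nat \<Rightarrow> real"
    assume s: "\<forall>i. s i \<in> {0..1} - {0}" "s \<longlonglongrightarrow> 0"
    have "(\<lambda>i. LINT c:?T|lborel. D (s i) c) \<longlonglongrightarrow> (LINT c:?T|lborel. D 0 c)"
      unfolding set_lebesgue_integral_def
    proof (rule integral_dominated_convergence[where w = "\<lambda>c. indicator ?T c *\<^sub>R B"])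
      show "integrable lborel (\<lambda>c. indicator ?T c *\<^sub>R B)"
        using set_integrable_weight_region[of \<epsilon> "\<lambda>_. B"] by (simp add: set_integrable_def)
      show "AE c in lborel. (\<lambda>i. indicator ?T c *\<^sub>R D (s i) c) \<longlonglongrightarrow> indicator ?T c *\<^sub>R D 0 c"
      proof (rule AE_I2)
        fix c :: "real \<times> real"
        show "(\<lambda>i. indicator ?T c *\<^sub>R D (s i) c) \<longlonglongrightarrow> indicator ?T c *\<^sub>R D 0 c"
        proof (cases "c \<in> ?T")
          case True
          have "(\<lambda>i. (s i, c)) \<longlonglongrightarrow> (0, c)"
            by (intro tendsto_intros s)
          from continuous_on_tendsto_compose[OF cont this] show ?thesis
            using s True by auto
        qed auto
      qed
      show "AE c in lborel. norm (indicator ?T c *\<^sub>R D (s i) c) \<le> indicator ?T c *\<^sub>R B" for i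
        using B s by (auto simp: indicator_def)
    qed (use int in \<open>auto simp: set_integrable_def intro: borel_measurable_integrable\<close>)
    then show "((\<lambda>r. LINT c:?T|lborel. D r c) \<circ> s) \<longlonglongrightarrow> (LINT c:?T|lborel. D 0 c)"
      by (simp add: o_def)
  qed
  then show ?thesis
    unfolding Error_ave_def D_def at_within_Icc_at_right[of 0 "1::real", OF zero_less_one]
    by (intro tendsto_intros)
qed

section \<open>Area, centroid and second moments of the triangle\<close>

lemma weight_region_integrals:
  fixes g :: "real \<Rightarrow> real"
  assumes "\<epsilon> \<le> 1" and g: "continuous_on UNIV g"
  shows weight_region_integral_fst:
      "(LINT c:weight_region \<epsilon>|lborel. g (fst c)) = (LINT u:{0..1 - \<epsilon>}|lborel. (1 - \<epsilon> - u) * g u)"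
    and weight_region_integral_snd:
      "(LINT c:weight_region \<epsilon>|lborel. g (snd c)) = (LINT u:{0..1 - \<epsilon>}|lborel. (1 - \<epsilon> - u) * g u)"
proof -
  let ?T = "weight_region \<epsilon>"
  have inner: "(LINT v|lborel. indicator ?T (u, v) * g u) = indicator {0..1 - \<epsilon>} u * ((1 - \<epsilon> - u) * g u)"
    "(LINT v|lborel. indicator ?T (v, u) * g u) = indicator {0..1 - \<epsilon>} u * ((1 - \<epsilon> - u) * g u)" for u
  proof -
    \<comment> \<open>Fubini: fixing either coordinate at \<open>u\<close> cuts the triangle in an
      interval of length \<open>1 - \<epsilon> - u\<close>, so both coordinates have the same
      marginal density.\<close>
    have *: "(indicator ?T (u, v) :: real) = indicator {0..1 - \<epsilon>} u * indicator {0..1 - \<epsilon> - u} v"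
      "(indicator ?T (v, u) :: real) = indicator {0..1 - \<epsilon>} u * indicator {0..1 - \<epsilon> - u} v" for v
      by (auto simp: weight_region_def indicator_def)
    show "(LINT v|lborel. indicator ?T (u, v) * g u) = indicator {0..1 - \<epsilon>} u * ((1 - \<epsilon> - u) * g u)"
      "(LINT v|lborel. indicator ?T (v, u) * g u) = indicator {0..1 - \<epsilon>} u * ((1 - \<epsilon> - u) * g u)"
      unfolding * by (auto simp: indicator_def[of "{0..1 - \<epsilon>}"])
  qed
  have "set_integrable lborel ?T (\<lambda>c. g (fst c))" "set_integrable lborel ?T (\<lambda>c. g (snd c))"
    by (intro set_integrable_weight_region continuous_on_compose2[OF g] continuous_intros; simp)+
  then have int: "integrable (lborel \<Otimes>\<^sub>M lborel) (\<lambda>(u, v). indicator ?T (u, v) * g u)"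
    "integrable (lborel \<Otimes>\<^sub>M lborel) (\<lambda>(u, v). indicator ?T (u, v) * g v)"
    by (simp_all add: set_integrable_def lborel_prod case_prod_unfold)
  show "(LINT c:?T|lborel. g (fst c)) = (LINT u:{0..1 - \<epsilon>}|lborel. (1 - \<epsilon> - u) * g u)"
    using lborel_pair.integral_fst[OF int(1), unfolded inner]
    by (simp add: set_lebesgue_integral_def lborel_prod case_prod_unfold)
  show "(LINT c:?T|lborel. g (snd c)) = (LINT u:{0..1 - \<epsilon>}|lborel. (1 - \<epsilon> - u) * g u)"
    using lborel_pair.integral_snd[OF int(2), unfolded inner]
    by (simp add: set_lebesgue_integral_def lborel_prod case_prod_unfold)
qed

lemma weight_region_area:
  assumes "\<epsilon> \<le> 1"
  shows "(LINT c:weight_region \<epsilon>|lborel. 1) = (1 - \<epsilon>)\<^sup>2 / 2"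
proof -
  define a where "a = 1 - \<epsilon>"
  have "(LINT u|lborel. (a - u) * indicator {0..a} u) = (a * a - a\<^sup>2 / 2) - (a * 0 - 0\<^sup>2 / 2)"
    using assms
    by (intro integral_FTC_Icc_real) (auto simp: a_def intro!: derivative_eq_intros continuous_intros)
  then show ?thesis
    using weight_region_integral_fst[OF assms, of "\<lambda>_. 1"]
    by (simp add: set_lebesgue_integral_def a_def mult.commute power2_eq_square)
qed

lemma weight_region_centroid:
  assumes "\<epsilon> \<le> 1"
  shows "(LINT c:weight_region \<epsilon>|lborel. fst c - (1 - \<epsilon>) / 3) = 0"
    and "(LINT c:weight_region \<epsilon>|lborel. snd c - (1 - \<epsilon>) / 3) = 0"
proof -
  define a where "a = 1 - \<epsilon>"
  \<comment> \<open>An antiderivative of \<open>(a - u) * (u - a / 3)\<close>, the density times the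
    deviation from the centroid; it vanishes at both 0 and \<open>a\<close>.\<close>
  define F where "F u = - (u ^ 3) / 3 + 2 * a * u\<^sup>2 / 3 - a\<^sup>2 * u / 3" for u
  have "(LINT u|lborel. ((a - u) * (u - a / 3)) * indicator {0..a} u) = F a - F 0"
    using assms unfolding F_def
    by (intro integral_FTC_Icc_real)
      (auto simp: a_def field_simps power2_eq_square intro!: derivative_eq_intros continuous_intros)
  also have "\<dots> = 0"
    by (simp add: F_def power2_eq_square power3_eq_cube)
  finally have 0: "(LINT u:{0..a}|lborel. (a - u) * (u - a / 3)) = 0"
    by (simp add: set_lebesgue_integral_def mult.commute mult.left_commute)
  have "continuous_on UNIV (\<lambda>u. u - a / 3)"
    by (intro continuous_intros)
  from weight_region_integrals[OF assms this] 0
  show "(LINT c:weight_region \<epsilon>|lborel. fst c - (1 - \<epsilon>) / 3) = 0"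
    "(LINT c:weight_region \<epsilon>|lborel. snd c - (1 - \<epsilon>) / 3) = 0"
    by (simp_all add: a_def)
qed

text \<open>The parallel axis theorem: moving the reference point from the centroid to
  \<open>(c1, c2)\<close> adds the area times the quadratic form of the displacement, because the
  cross terms integrate to zero.\<close>

lemma weight_region_moment:
  fixes m :: real
  assumes "\<epsilon> \<le> 1"
  defines "b \<equiv> (1 - \<epsilon>) / 3"
  defines "M \<equiv> \<lambda>c1 c2. LINT c:weight_region \<epsilon>|lborel. 4 * (c1 - fst c)\<^sup>2 + 4 * m * (c2 - snd c)\<^sup>2"
  shows "M c1 c2 = M b b + (1 - \<epsilon>)\<^sup>2 / 2 * (4 * (c1 - b)\<^sup>2 + 4 * m * (c2 - b)\<^sup>2)"
proof -
  let ?T = "weight_region \<epsilon>"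
  let ?q = "4 * (c1 - b)\<^sup>2 + 4 * m * (c2 - b)\<^sup>2"
  have int: "set_integrable lborel ?T f" if "continuous_on UNIV f" for f :: "real \<times> real \<Rightarrow> real"
    using continuous_on_subset[OF that] by (intro set_integrable_weight_region) auto
  \<comment> \<open>Each square is expanded about \<open>b\<close>. The displacement term is written
    \<open>?q * 1\<close> so that pulling out the constant leaves the area integral.\<close>
  have "M c1 c2 = (LINT c:?T|lborel. ((4 * (b - fst c)\<^sup>2 + 4 * m * (b - snd c)\<^sup>2) + ?q * 1)
      + (8 * (b - c1) * (fst c - b) + 8 * m * (b - c2) * (snd c - b)))"
    unfolding M_def
    by (rule arg_cong[where f = "set_lebesgue_integral lborel ?T"])
      (auto simp: power2_eq_square algebra_simps)
  also have "\<dots> = M b b + ?q * (LINT c:?T|lborel. 1)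
      + (8 * (b - c1) * (LINT c:?T|lborel. fst c - b) + 8 * m * (b - c2) * (LINT c:?T|lborel. snd c - b))"
    unfolding M_def
    by (subst set_integral_add(2) set_integral_mult_right; (intro int continuous_intros)?)+ simp
  also have "\<dots> = M b b + (1 - \<epsilon>)\<^sup>2 / 2 * ?q"
    using assms(1) weight_region_centroid[OF assms(1)] by (simp add: weight_region_area b_def)
  finally show ?thesis .
qed

section \<open>The limit of vanishing \<open>R1\<close>, and the minimizer\<close>

lemma Error_ave_at_0:
  fixes x :: "real ^ 'n::finite" and y :: "'p::finite \<Rightarrow> real ^ 'n"
  assumes "0 < \<epsilon>"
  shows "Error_ave C1 C2 0 \<epsilon> x y =
    2 / (1 - \<epsilon>)\<^sup>2 *
      (R1 x y * (LINT c:weight_region \<epsilon>|lborel. (1 / (1 - C1 - C2) - 1 / (1 - fst c - snd c))\<^sup>2 / 64)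
       + (LINT c:weight_region \<epsilon>|lborel. 4 * (C1 - fst c)\<^sup>2 + 4 * real CARD('n) * (C2 - snd c)\<^sup>2))"
proof -
  \<comment> \<open>On the region \<open>1 - fst c - snd c\<close> is at least \<epsilon>, so the
    reciprocal is continuous there; integrability of both parts is what lets the integral be
    split.\<close>
  have "set_integrable lborel (weight_region \<epsilon>) (\<lambda>c. (1 / (1 - C1 - C2) - 1 / (1 - fst c - snd c))\<^sup>2 / 64)"
    using assms
    by (intro set_integrable_weight_region continuous_intros) (auto simp: weight_region_def)
  moreover have "set_integrable lborel (weight_region \<epsilon>)
      (\<lambda>c. 4 * (C1 - fst c)\<^sup>2 + 4 * real CARD('n) * (C2 - snd c)\<^sup>2)"
    by (intro set_integrable_weight_region continuous_intros)
  ultimately show ?thesis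
    unfolding Error_ave_def kkt_dist_at_0
    by (simp add: set_integral_add(2) set_integral_mult_right)
qed

theorem theorem3p10:
  fixes \<epsilon> :: real
  assumes "0 < \<epsilon>" and "\<epsilon> < 1"
  shows "\<exists>(E0 :: real \<times> real \<Rightarrow> real ^ 'n::finite \<Rightarrow> ('p::finite \<Rightarrow> real ^ 'n) \<Rightarrow> real)
          (L :: real \<times> real \<Rightarrow> real).
      (\<forall>(C1, C2) \<in> weight_region \<epsilon>. \<forall>x y.
         ((\<lambda>r. Error_ave C1 C2 r \<epsilon> x y) \<longlongrightarrow> E0 (C1, C2) x y) (at_right 0)) \<and>
      (\<forall>c \<in> weight_region \<epsilon>. \<forall>X Y.
         (\<lambda>k. R1 (X k) (Y k)) \<longlonglongrightarrow> 0 \<longrightarrow> (\<lambda>k. E0 c (X k) (Y k)) \<longlonglongrightarrow> L c) \<and>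
      (\<forall>c. is_arg_min L (\<lambda>c. c \<in> weight_region \<epsilon>) c \<longleftrightarrow> c = ((1 - \<epsilon>) / 3, (1 - \<epsilon>) / 3))"
proof -
  define b where "b = (1 - \<epsilon>) / 3"
  define M where "M = (\<lambda>(c1, c2). LINT c:weight_region \<epsilon>|lborel.
    4 * (c1 - fst c)\<^sup>2 + 4 * real CARD('n) * (c2 - snd c)\<^sup>2)"
  define E0 :: "real \<times> real \<Rightarrow> real ^ 'n \<Rightarrow> ('p \<Rightarrow> real ^ 'n) \<Rightarrow> real"
    where "E0 = (\<lambda>(C1, C2) x y. Error_ave C1 C2 0 \<epsilon> x y)"
  define L where "L c = 2 / (1 - \<epsilon>)\<^sup>2 * M c" for c
  have limit_R1: "(\<lambda>k. E0 c (X k) (Y k)) \<longlonglongrightarrow> L c" if "(\<lambda>k. R1 (X k) (Y k)) \<longlonglongrightarrow> 0" for c X Y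
  proof -
    obtain c1 c2 where c: "c = (c1, c2)" by fastforce
    \<comment> \<open>The point configuration enters only through \<open>R1\<close>; its coefficient
      \<open>K\<close> is fixed along the sequence, so the term tends to zero.\<close>
    define K where
      "K = (LINT c:weight_region \<epsilon>|lborel. (1 / (1 - c1 - c2) - 1 / (1 - fst c - snd c))\<^sup>2 / 64)"
    have "(\<lambda>k. 2 / (1 - \<epsilon>)\<^sup>2 * (R1 (X k) (Y k) * K + M c)) \<longlonglongrightarrow> 2 / (1 - \<epsilon>)\<^sup>2 * (0 * K + M c)"
      by (intro tendsto_intros that)
    then show ?thesis
      by (simp add: c E0_def L_def M_def K_def Error_ave_at_0[OF assms(1)])
  qed
  \<comment> \<open>The normalization \<open>2 / (1 - \<epsilon>)\<^sup>2\<close> is the reciprocal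
    of the area and cancels it in the parallel axis formula.\<close>
  have L: "L (c1, c2) = L (b, b) + (4 * (c1 - b)\<^sup>2 + 4 * real CARD('n) * (c2 - b)\<^sup>2)" for c1 c2
    using weight_region_moment[where \<epsilon> = \<epsilon> and m = "real CARD('n)" and ?c1.0 = c1 and ?c2.0 = c2] assms
    by (simp add: L_def M_def b_def distrib_left)
  \<comment> \<open>Both coefficients are positive because \<open>CARD('n)\<close> is, so the
    quadratic form is definite and \<open>(b, b)\<close> is the strict minimizer even over the whole
    plane; as it lies in the triangle, it is the unique minimizer there.\<close>
  have min: "L (b, b) < L c" if "c \<noteq> (b, b)" for c
  proof -
    obtain c1 c2 where c: "c = (c1, c2)" by fastforce
    then have "c1 \<noteq> b \<or> c2 \<noteq> b"
      using that by auto
    then have "0 < 4 * (c1 - b)\<^sup>2 + 4 * real CARD('n) * (c2 - b)\<^sup>2"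
      by (auto intro: add_pos_nonneg add_nonneg_pos)
    then show ?thesis
      using L[of c1 c2] c by simp
  qed
  have "(b, b) \<in> weight_region \<epsilon>"
    using assms by (auto simp: weight_region_def b_def)
  with min have "is_arg_min L (\<lambda>c. c \<in> weight_region \<epsilon>) c \<longleftrightarrow> c = (b, b)" for c
    by (metis is_arg_min_def less_asym less_irrefl)
  then show ?thesis
    using limit_R1 Error_ave_tendsto[OF assms(1)]
    by (intro exI[of _ E0] exI[of _ L]) (auto simp: E0_def b_def)
qed

end
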